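(* Let $p$ be a prime with $p\neq 2,5$. Let $(u_n)_{n\ge0}$ and $(v_n)_{n\ge 0}$ be the integer sequences with $u_0=0$, $u_1=1$, $u_{n+1}=5u_n-5u_{n-1}$ and $v_0=2$, $v_1=5$, $v_{n+1}=5v_n-5v_{n-1}$ for $n\ge1$. Then $$\sum_{k=0}^{p-1}\frac{u_k}{5^k}\binom{2k}{k}\equiv(-1)^{\lfloor p/5\rfloor}\left(\left(\frac p5\right)-1\right)\pmod{p^2}$$ and $$\sum_{k=0}^{p-1}\frac{u_{k+1}}{5^k}\binom{2k}{k}\equiv(-1)^{\lfloor p/5\rfloor}\left(2\left(\frac p5\right)-1\right)\pmod{p^2}.$$ Also, $$\sum_{k=0}^{(p-1)/2}\frac{u_k}{16^k}\binom{2k}{k}\equiv\frac{5\left(\frac p5\right)-1}{2}\pmod{p^2}$$ and $$\sum_{k=0}^{(p-1)/2}\frac{v_k}{16^k}\binom{2k}{k}\equiv\frac{\left(\frac p5\right)-1}{2}\pmod{p^2}.$$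
   Context: $\left(\frac{\cdot}{\cdot}\right)$ is the Jacobi symbol. A congruence $a\equiv b\pmod{p^2}$ between rational numbers whose denominators are prime to $p$ means $a-b\in p^2\mathbb{Z}_{(p)}$. The sequences $u_n=u_n(5,5)$, $v_n=v_n(5,5)$ are the Lucas sequence and companion Lucas sequence with parameters $A=B=5$; $v_n=\alpha^n+\beta^n$ for the roots $\alpha,\beta$ of $x^2-5x+5=0$.
   Formalization: The right-hand sides of the last two congruences are interchanged: the u-sum is proved congruent to ((p/5)-1)/2 and the v-sum to (5(p/5)-1)/2; as printed both fail, e.g. at p=3, where the u-sum is -1 and the v-sum is -3 mod 9. *)

theory Defs
  imports "HOL-Number_Theory.Number_Theory"
begin

definition Jacobi :: "int \<Rightarrow> nat \<Rightarrow> int" where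
  "Jacobi a n = (\<Prod>q\<in>#prime_factorization n. Legendre a (int q))"

text \<open>
  The localization of the integers at the prime \<open>p\<close>, as a subring of the rationals.
  \<open>quotient_of\<close> returns numerator and denominator in lowest terms.
\<close>

definition localization :: "nat \<Rightarrow> rat set" where
  "localization p = {x. \<not> int p dvd snd (quotient_of x)}"

text \<open>Congruence modulo \<open>p ^ n\<close> in the localization at \<open>p\<close>.\<close>

definition loc_cong :: "nat \<Rightarrow> nat \<Rightarrow> rat \<Rightarrow> rat \<Rightarrow> bool" where
  "loc_cong p n a b \<longleftrightarrow> (\<exists>c\<in>localization p. a - b = of_nat p ^ n * c)"

lemma Jacobi_prime: "prime q \<Longrightarrow> Jacobi a q = Legendre a (int q)"
  by (simp add: Jacobi_def prime_factorization_prime)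

text \<open>
  Erratum to the source. In the two congruences with \<open>16 ^ k\<close>, the source pairs the
  sum over \<open>u\<close> with \<open>(5 * Jacobi p 5 - 1) / 2\<close> and the sum over \<open>v\<close> with
  \<open>(Jacobi p 5 - 1) / 2\<close>. As printed both are false, already for \<open>p = 3\<close>, as the
  following lemma shows. The theorem is stated with the two right-hand sides interchanged.
\<close>

lemma source_misprint:
  fixes u v :: "nat \<Rightarrow> int"
  assumes "u 0 = 0" "u 1 = 1" "v 0 = 2" "v 1 = 5"
  shows "\<not> loc_cong 3 2 (\<Sum>k=0..(3 - 1) div 2. of_int (u k) / 16 ^ k * of_nat ((2 * k) choose k))
           ((5 * of_int (Jacobi (int 3) 5) - 1) / 2)"
    and "\<not> loc_cong 3 2 (\<Sum>k=0..(3 - 1) div 2. of_int (v k) / 16 ^ k * of_nat ((2 * k) choose k))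
           ((of_int (Jacobi (int 3) 5) - 1) / 2)"
proof -
  have "\<not> QuadRes 5 3"
  proof
    assume "QuadRes 5 3"
    then obtain y :: int where "y\<^sup>2 mod 5 = 3"
      by (auto simp: QuadRes_def cong_def)
    moreover have "y mod 5 \<in> {0, 1, 2, 3, 4}"
      by (simp add: insert_iff) presburger
    moreover have "y\<^sup>2 mod 5 = (y mod 5)\<^sup>2 mod 5"
      by (simp add: power_mod)
    ultimately show False
      by auto
  qed
  then have J: "Jacobi 3 5 = -1"
    by (simp add: Jacobi_prime Legendre_def cong_def)
  have q: "quotient_of (25 / 72) = (25, 72)" "quotient_of (29 / 72) = (29, 72)"
    by (simp_all add: rat_divide_code normalize_def gcd_non_0_int Let_def)
  have *: "\<not> loc_cong 3 2 a b" if "a - b = 25 / 8 \<or> a - b = 29 / 8" for a b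
  proof
    assume "loc_cong 3 2 a b"
    then obtain c where c: "c \<in> localization 3" "a - b = 9 * c"
      by (auto simp: loc_cong_def)
    with that have "c = 25 / 72 \<or> c = 29 / 72"
      by auto
    then have "snd (quotient_of c) = 72"
      by (elim disjE) (simp_all only: q snd_conv)
    with c(1) show False
      by (simp add: localization_def)
  qed
  show "\<not> loc_cong 3 2 (\<Sum>k=0..(3 - 1) div 2. of_int (u k) / 16 ^ k * of_nat ((2 * k) choose k))
           ((5 * of_int (Jacobi (int 3) 5) - 1) / 2)"
    by (rule *) (use assms J in simp)
  show "\<not> loc_cong 3 2 (\<Sum>k=0..(3 - 1) div 2. of_int (v k) / 16 ^ k * of_nat ((2 * k) choose k))
           ((of_int (Jacobi (int 3) 5) - 1) / 2)"
    by (rule *) (use assms J in simp)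
qed

end

theory Submission
  imports Defs
begin

text \<open>
  Let \<open>\<alpha>\<close>, \<open>\<beta>\<close> be the roots of \<open>x\<^sup>2 - 5 * x + 5\<close>. Since \<open>\<alpha> ^ k = u (k + 1) - u k * \<beta>\<close>, each pair of
  sums is read off from one sum in the ring of integers extended by \<open>\<beta>\<close>, with \<open>\<alpha> ^ k\<close> in
  place of \<open>u k\<close>. Write \<open>p = 2 * n + 1\<close> and let \<open>U\<close> be the Lucas sequence with parameters \<open>A\<close> and \<open>1\<close>.

  As \<open>\<alpha> * \<beta> = 5\<close>, the sums with \<open>5 ^ k\<close> come from the sum of \<open>(2 * k choose k) * \<beta> ^ (p - 1 - k)\<close>,
  which can be expressed through \<open>U\<close> with \<open>A = \<beta> - 2\<close>. For the sums with \<open>16 ^ k\<close>, the binomial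
  coefficient \<open>2 * k choose k\<close> is congruent to \<open>(- 16) ^ k * (n + k choose (2 * k))\<close> modulo \<open>p\<^sup>2\<close>, and
  the sum of \<open>(n + k choose (2 * k)) * (- \<alpha>) ^ k\<close> equals \<open>U (n + 1) - U n\<close> with \<open>A = \<beta> - 3\<close>. These
  values of \<open>A\<close> have the form \<open>\<zeta> + 1 / \<zeta>\<close> for a root of unity \<open>\<zeta>\<close> of order 10 and 5, respectively, so
  that \<open>U (m + 5)\<close> is \<open>- U m\<close> or \<open>U m\<close> and everything depends only on \<open>p\<close> modulo 10.
\<close>

section \<open>Lucas sequences and binomial sums over a commutative ring\<close>

text \<open>For \<open>A = z + 1 / z\<close> the value is
  \<open>(z ^ n - 1 / z ^ n) / (z - 1 / z)\<close>. The ring is arbitrary because \<open>A\<close>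
  will lie in \<open>zbeta\<close>.\<close>

fun lucas_U :: "'a::comm_ring_1 \<Rightarrow> nat \<Rightarrow> 'a" where
  "lucas_U A 0 = 0"
| "lucas_U A (Suc 0) = 1"
| "lucas_U A (Suc (Suc n)) = A * lucas_U A (Suc n) - lucas_U A n"

text \<open>By the recurrence, moving one unit from \<open>m\<close> to \<open>n\<close> leaves the
  right-hand side unchanged. The case \<open>m = n\<close> factors the value at
  \<open>2 * n + 1\<close>; the case \<open>m = 4\<close> gives the shift by five.\<close>

lemma lucas_U_add:
  "lucas_U A (Suc (m + n)) = lucas_U A (Suc m) * lucas_U A (Suc n) - lucas_U A m * lucas_U A n"
proof (induction m arbitrary: n)
  case 0
  then show ?case by simp
next
  case (Suc m)
  show ?case
    using Suc.IH[of "Suc n"] by (simp add: algebra_simps)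
qed

lemma sum_choose_Suc_mult:
  fixes h :: "nat \<Rightarrow> 'a::comm_ring_1"
  shows "(\<Sum>k<Suc n. of_nat (Suc N choose k) * h k) =
    (\<Sum>k<Suc n. of_nat (N choose k) * h k) + (\<Sum>k<n. of_nat (N choose k) * h (Suc k))"
  by (induction n) (simp_all add: algebra_simps)

text \<open>Two uses of Pascal's rule, for inductions in which the upper entry of the binomial
  coefficient grows by two.\<close>

lemma sum_choose_Suc_Suc_mult:
  fixes h :: "nat \<Rightarrow> 'a::comm_ring_1"
  shows "(\<Sum>k<Suc (Suc n). of_nat (Suc (Suc N) choose k) * h k) =
    (\<Sum>k<Suc (Suc n). of_nat (N choose k) * h k) + 2 * (\<Sum>k<Suc n. of_nat (N choose k) * h (Suc k))
    + (\<Sum>k<n. of_nat (N choose k) * h (Suc (Suc k)))"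
  unfolding sum_choose_Suc_mult by simp

text \<open>Both sides satisfy \<open>S (n + 1) = (A + 2) * S n + (2 * n choose n)\<close>.\<close>

lemma sum_central_binomial_lucas_U:
  fixes A :: "'a::comm_ring_1"
  shows "(\<Sum>k<n. of_nat (2 * k choose k) * (A + 2) ^ (n - 1 - k)) =
    (\<Sum>k<n. of_nat (2 * n choose k) * lucas_U A (n - k))"
proof (induction n)
  case 0
  then show ?case by simp
next
  case (Suc n)
  show ?case
  proof (cases n)
    case 0
    then show ?thesis by simp
  next
    case (Suc l)
    let ?c = "\<lambda>k. of_nat (2 * n choose k) :: 'a"
    have "(\<Sum>k<Suc n. of_nat (2 * Suc n choose k) * lucas_U A (Suc n - k)) =
      (\<Sum>k<Suc n. ?c k * lucas_U A (Suc n - k)) + 2 * (\<Sum>k<n. ?c k * lucas_U A (n - k))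
      + (\<Sum>k<l. ?c k * lucas_U A (l - k))"
      using sum_choose_Suc_Suc_mult[of "2 * n" "\<lambda>k. lucas_U A (Suc n - k)" l] Suc by simp
    \<comment> \<open>The added term \<open>k = l\<close> vanishes because
      \<open>lucas_U A 0 = 0\<close>.\<close>
    also have "(\<Sum>k<l. ?c k * lucas_U A (l - k)) = (\<Sum>k<n. ?c k * lucas_U A (n - Suc k))"
      using Suc by simp
    \<comment> \<open>The term \<open>k = n\<close> is split off because the recurrence does not
      reach \<open>lucas_U A 1\<close>. The subtracted terms cancel the sum just extended.\<close>
    also have "(\<Sum>k<Suc n. ?c k * lucas_U A (Suc n - k)) =
        ?c n + (\<Sum>k<n. ?c k * (A * lucas_U A (n - k) - lucas_U A (n - Suc k)))"
    proof -
      have "lucas_U A (Suc n - k) = A * lucas_U A (n - k) - lucas_U A (n - Suc k)" if "k < n" for k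
      proof -
        from that have "Suc n - k = Suc (Suc (n - Suc k))" "n - k = Suc (n - Suc k)" by auto
        then show ?thesis by (simp del: diff_Suc_Suc)
      qed
      then show ?thesis by (simp add: add.commute)
    qed
    finally have "(\<Sum>k<Suc n. of_nat (2 * Suc n choose k) * lucas_U A (Suc n - k)) =
        ?c n + (A + 2) * (\<Sum>k<n. ?c k * lucas_U A (n - k))"
      by (simp add: algebra_simps sum_distrib_left sum_subtractf sum.distrib)
    also have "\<dots> = ?c n + (A + 2) * (\<Sum>k<n. of_nat (2 * k choose k) * (A + 2) ^ (n - 1 - k))"
      by (simp only: Suc.IH)
    also have "\<dots> = ?c n + (\<Sum>k<n. of_nat (2 * k choose k) * (A + 2) ^ (n - k))"
    proof -
      have "(A + 2) ^ (n - k) = (A + 2) * (A + 2) ^ (n - 1 - k)" if "k < n" for k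
      proof -
        from that have "n - k = Suc (n - 1 - k)" by simp
        then show ?thesis by (metis power_Suc)
      qed
      then show ?thesis by (simp add: sum_distrib_left mult.left_commute)
    qed
    finally show ?thesis by (simp add: add.commute)
  qed
qed

text \<open>On solutions of the recurrence the shift operator \<open>E\<close> satisfies
  \<open>(1 + E) ^ 2 = (A + 2) * E\<close>, and the sum is \<open>(1 + E) ^ (2 * n + 1)\<close>
  applied at \<open>r\<close>. The offset \<open>r\<close> lets the induction absorb the factor
  \<open>E\<close>.\<close>

lemma sum_choose_lucas_U:
  fixes A :: "'a::comm_ring_1"
  shows "(\<Sum>k\<le>2 * n + 1. of_nat (2 * n + 1 choose k) * lucas_U A (k + r)) =
    (A + 2) ^ n * (lucas_U A (n + r) + lucas_U A (Suc (n + r)))"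
proof (induction n arbitrary: r)
  case 0
  then show ?case by simp
next
  case (Suc n)
  have pascal: "(\<Sum>k\<le>Suc N. of_nat (Suc N choose k) * h k) =
      (\<Sum>k\<le>N. of_nat (N choose k) * (h k + h (Suc k)))" for N and h :: "nat \<Rightarrow> 'a"
    using sum_choose_Suc_mult[of N h "Suc N"]
    by (simp add: lessThan_Suc_atMost sum.distrib algebra_simps binomial_eq_0)
  have "(\<Sum>k\<le>2 * Suc n + 1. of_nat (2 * Suc n + 1 choose k) * lucas_U A (k + r)) =
      (\<Sum>k\<le>Suc (Suc (2 * n + 1)). of_nat (Suc (Suc (2 * n + 1)) choose k) * lucas_U A (k + r))"
    by simp
  also have "\<dots> = (\<Sum>k\<le>2 * n + 1. of_nat (2 * n + 1 choose k) * ((A + 2) * lucas_U A (k + Suc r)))"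
    unfolding pascal by (intro sum.cong) (simp_all add: algebra_simps)
  also have "\<dots> = (A + 2) * (\<Sum>k\<le>2 * n + 1. of_nat (2 * n + 1 choose k) * lucas_U A (k + Suc r))"
    by (simp only: sum_distrib_left mult.left_commute)
  also have "\<dots> = (A + 2) ^ Suc n * (lucas_U A (Suc n + r) + lucas_U A (Suc (Suc n + r)))"
    by (simp only: Suc.IH) (simp add: mult.assoc)
  finally show ?case .
qed

text \<open>For \<open>A + 2 = (w + 1 / w) ^ 2\<close> this is the expansion of
  \<open>(w + 1 / w) ^ (2 * n + 1)\<close> with opposite terms paired, divided by
  \<open>w + 1 / w\<close>. The induction shows that the sum gains a factor \<open>A + 2\<close> at
  each step.\<close>

lemma power_eq_sum_choose_lucas_U:
  fixes A :: "'a::comm_ring_1"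
  shows "(A + 2) ^ n =
    (\<Sum>k\<le>n. of_nat (2 * n + 1 choose k) * (lucas_U A (Suc (n - k)) - lucas_U A (n - k)))"
proof (induction n)
  case 0
  then show ?case by simp
next
  case (Suc n)
  define F where "F j = lucas_U A (Suc j) - lucas_U A j" for j
  let ?c = "\<lambda>k. of_nat (2 * n + 1 choose k) :: 'a"
  have F_rec: "F (Suc (Suc j)) = A * F (Suc j) - F j" for j
    by (simp add: F_def algebra_simps)
  have "(\<Sum>k<Suc (Suc n). of_nat (2 * Suc n + 1 choose k) * F (Suc n - k)) =
      (\<Sum>k<Suc (Suc n). ?c k * F (Suc n - k)) + 2 * (\<Sum>k<Suc n. ?c k * F (n - k))
      + (\<Sum>k<n. ?c k * F (n - Suc k))"
    using sum_choose_Suc_Suc_mult[of "2 * n + 1" "\<lambda>k. F (Suc n - k)" n]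
    by (simp del: sum.lessThan_Suc binomial_Suc_Suc)
  also have "(\<Sum>k<Suc (Suc n). ?c k * F (Suc n - k)) =
      ?c (Suc n) * F 0 + ?c n * F 1 + (\<Sum>k<n. ?c k * (A * F (n - k) - F (n - Suc k)))"
  proof -
    have "F (Suc n - k) = A * F (n - k) - F (n - Suc k)" if "k < n" for k
    proof -
      from that have "Suc n - k = Suc (Suc (n - Suc k))" "n - k = Suc (n - Suc k)" by auto
      then show ?thesis by (simp only: F_rec)
    qed
    then show ?thesis by (simp add: add_ac del: binomial_Suc_Suc)
  qed
  \<comment> \<open>By this symmetry and \<open>F 0 = 1\<close>, \<open>F 1 = A - 1\<close>, the two
    boundary terms add up to \<open>A * ?c n\<close>, the missing term \<open>k = n\<close>.\<close>
  also have "?c (Suc n) = ?c n"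
    using binomial_symmetric[of n "2 * n + 1"] by simp
  finally have "(\<Sum>k<Suc (Suc n). of_nat (2 * Suc n + 1 choose k) * F (Suc n - k)) =
      (A + 2) * (\<Sum>k<Suc n. ?c k * F (n - k))"
    by (simp add: F_def algebra_simps sum_distrib_left sum_subtractf sum.distrib
             del: binomial_Suc_Suc)
  then show ?case
    by (simp only: lessThan_Suc_atMost F_def Suc.IH power_Suc)
qed

text \<open>Pascal's rule couples the sum with its companion over
  \<open>n + k choose (2 * k + 1)\<close>, which equals \<open>lucas_U A n\<close>. The pair obeys
  the first-order system of the Lucas sequence and its differences.\<close>

lemma sum_choose_power_eq_lucas_U:
  fixes A :: "'a::comm_ring_1"
  shows "(\<Sum>k\<le>n. of_nat (n + k choose (2 * k)) * (A - 2) ^ k) = lucas_U A (Suc n) - lucas_U A n"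
proof -
  define x where "x = A - 2"
  define a where "a n = (\<Sum>k\<le>n. of_nat (n + k choose (2 * k)) * x ^ k)" for n
  define b where "b n = (\<Sum>k\<le>n. of_nat (n + k choose (2 * k + 1)) * x ^ k)" for n
  have b_Suc: "b (Suc n) = a n + b n" for n
    by (simp add: a_def b_def sum.distrib algebra_simps binomial_eq_0)
  have a_Suc: "a (Suc n) = a n + x * b (Suc n)" for n
  proof -
    have "a (Suc n) = 1 + (\<Sum>k\<le>n. of_nat (Suc n + Suc k choose (2 * Suc k)) * x ^ Suc k)"
      unfolding a_def by (subst sum.atMost_Suc_shift) simp
    also have "\<dots> = (1 + (\<Sum>k\<le>n. of_nat (n + Suc k choose (2 * Suc k)) * x ^ Suc k))
        + (\<Sum>k\<le>n. of_nat (Suc n + k choose (2 * k + 1)) * x ^ Suc k)"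
      by (simp add: sum.distrib sum_distrib_left algebra_simps)
    also have "1 + (\<Sum>k\<le>n. of_nat (n + Suc k choose (2 * Suc k)) * x ^ Suc k)
        = (\<Sum>k\<le>Suc n. of_nat (n + k choose (2 * k)) * x ^ k)"
      by (subst sum.atMost_Suc_shift) simp
    also have "\<dots> = a n"
      by (simp add: a_def binomial_eq_0)
    also have "(\<Sum>k\<le>n. of_nat (Suc n + k choose (2 * k + 1)) * x ^ Suc k) = x * b (Suc n)"
      by (simp add: b_def sum_distrib_left binomial_eq_0 mult_ac del: binomial_Suc_Suc)
    finally show ?thesis .
  qed
  have "a n = lucas_U A (Suc n) - lucas_U A n \<and> b n = lucas_U A n"
  proof (induction n)
    case 0
    then show ?case by (simp add: a_def b_def)
  next
    case (Suc n)
    then show ?case by (simp add: a_Suc b_Suc x_def algebra_simps)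
  qed
  then show ?thesis by (simp add: a_def x_def)
qed

section \<open>Congruences modulo the square of a prime\<close>

text \<open>In Vandermonde's sum for \<open>p + p\<close> the two end terms give
  \<open>2 * (p choose k)\<close>; in every other term both factors are divisible by
  \<open>p\<close>.\<close>

lemma double_prime_choose_cong:
  assumes "prime p" "0 < k" "k < p"
  shows "[int (2 * p choose k) = 2 * int (p choose k)] (mod int p ^ 2)"
proof -
  have "(2 * p choose k) = (\<Sum>i\<le>k. (p choose i) * (p choose (k - i)))"
    using vandermonde[of p p k] by (simp add: mult_2)
  also have "\<dots> = (p choose k) + (p choose k) + (\<Sum>i\<in>{0<..<k}. (p choose i) * (p choose (k - i)))"
  proof -
    have "{..k} = insert 0 (insert k {0<..<k})" using assms by auto
    then show ?thesis using assms by simp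
  qed
  finally have eq: "int (2 * p choose k) - 2 * int (p choose k) =
      int (\<Sum>i\<in>{0<..<k}. (p choose i) * (p choose (k - i)))"
    by simp
  have "p ^ 2 dvd (\<Sum>i\<in>{0<..<k}. (p choose i) * (p choose (k - i)))"
    unfolding power2_eq_square
    using assms by (intro dvd_sum mult_dvd_mono dvd_choose_prime) auto
  then have "int p ^ 2 dvd int (\<Sum>i\<in>{0<..<k}. (p choose i) * (p choose (k - i)))"
    by (metis of_nat_dvd_iff of_nat_power)
  then show ?thesis
    by (simp add: cong_iff_dvd_diff eq)
qed

lemma of_nat_dvd_of_nat: "a dvd b \<Longrightarrow> of_nat a dvd (of_nat b :: 'a::comm_semiring_1)"
  by (auto simp: dvd_def)

lemma of_int_dvd_of_int: "a dvd b \<Longrightarrow> of_int a dvd (of_int b :: 'a::comm_ring_1)"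
  by (auto simp: dvd_def)

text \<open>
  With \<open>U = lucas_U A\<close>, \<open>F = U (n + 1) - U n\<close> and \<open>E = U (n + 1) + U n = g * F\<close>, the sum is
  congruent to \<open>2 * M * E - E * F\<close> modulo \<open>p\<^sup>2\<close>, where \<open>M = (A + 2) ^ n\<close> is congruent to \<open>F\<close>
  modulo \<open>p\<close>; hence it differs from \<open>g * M\<^sup>2\<close> by \<open>g * (M - F)\<^sup>2\<close>.
\<close>

lemma sum_central_binomial_cong:
  fixes A g :: "'a::comm_ring_1"
  assumes p: "prime p" "p = 2 * n + 1"
    and g: "lucas_U A (Suc n) + lucas_U A n = g * (lucas_U A (Suc n) - lucas_U A n)"
  shows "of_nat p ^ 2 dvd (\<Sum>k<p. of_nat (2 * k choose k) * (A + 2) ^ (p - 1 - k)) - g * (A + 2) ^ (p - 1)"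
proof -
  let ?U = "lucas_U A"
  define F where "F = ?U (Suc n) - ?U n"
  define M where "M = (A + 2) ^ n"
  let ?S = "(\<Sum>k<p. of_nat (2 * k choose k) * (A + 2) ^ (p - 1 - k))"
  have "of_nat p dvd M - F"
  proof -
    have "M - F = (\<Sum>k\<in>{0<..n}. of_nat (p choose k) * (?U (Suc (n - k)) - ?U (n - k)))"
    proof -
      have "{..n} = insert 0 {0<..n}" by auto
      then show ?thesis
        using p(2) by (simp add: M_def F_def power_eq_sum_choose_lucas_U del: binomial_Suc_Suc)
    qed
    moreover have "(of_nat p :: 'a) dvd of_nat (p choose k)" if "k \<in> {0<..n}" for k
      using that p by (intro of_nat_dvd_of_nat dvd_choose_prime) auto
    ultimately show ?thesis
      by (auto intro!: dvd_sum dvd_mult2)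
  qed
  then have sq: "of_nat p ^ 2 dvd g * (M - F) ^ 2"
    by (intro dvd_mult dvd_power_same)
  have Up: "?U p = g * F ^ 2"
  proof -
    have "?U p = (?U (Suc n) + ?U n) * (?U (Suc n) - ?U n)"
      using lucas_U_add[of A n n] p(2) by (simp add: algebra_simps mult_2_right)
    then show ?thesis
      using g by (simp add: F_def power2_eq_square mult.assoc)
  qed
  \<comment> \<open>The sum from \<open>sum_choose_lucas_U\<close> at \<open>r = 0\<close> is
    reversed by the symmetry of the binomial coefficients; its term \<open>k = p\<close> then drops
    out, as \<open>?U 0 = 0\<close>.\<close>
  have "2 * (M * (g * F)) = 2 * (\<Sum>k\<le>p. of_nat (p choose k) * ?U k)"
    using sum_choose_lucas_U[of n A 0] p(2) g by (simp add: M_def F_def add.commute)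
  also have "(\<Sum>k\<le>p. of_nat (p choose k) * ?U k) = (\<Sum>k\<le>p. of_nat (p choose (p - k)) * ?U (p - k))"
    using sum.nat_diff_reindex[of "\<lambda>k. of_nat (p choose k) * ?U k" "Suc p"]
    by (simp add: lessThan_Suc_atMost)
  also have "\<dots> = (\<Sum>k\<le>p. of_nat (p choose k) * ?U (p - k))"
    by (intro sum.cong) (simp_all add: binomial_symmetric[symmetric])
  also have "\<dots> = (\<Sum>k<p. of_nat (p choose k) * ?U (p - k))"
    by (simp flip: lessThan_Suc_atMost)
  finally have E: "2 * (M * (g * F)) = 2 * (\<Sum>k<p. of_nat (p choose k) * ?U (p - k))" .
  have ins: "{..<p} = insert 0 {0<..<p}"
    using p by auto
  have "?S = (\<Sum>k<p. of_nat (2 * p choose k) * ?U (p - k))"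
    by (rule sum_central_binomial_lucas_U)
  \<comment> \<open>At \<open>k = 0\<close> the coefficient is 1 in the expansion of
    \<open>?S\<close> but 2 in the doubled sum, which accounts for \<open>?U p\<close>.\<close>
  then have "?S - (2 * (M * (g * F)) - ?U p) =
      (\<Sum>k\<in>{0<..<p}. (of_nat (2 * p choose k) - 2 * of_nat (p choose k)) * ?U (p - k))"
    unfolding E ins by (simp add: algebra_simps sum_subtractf sum_distrib_left)
  also have "of_nat p ^ 2 dvd \<dots>"
  proof (intro dvd_sum dvd_mult2)
    fix k assume "k \<in> {0<..<p}"
    then have "int p ^ 2 dvd int (2 * p choose k) - 2 * int (p choose k)"
      using double_prime_choose_cong[of p k] p by (simp add: cong_iff_dvd_diff)
    from of_int_dvd_of_int[OF this, where 'a = 'a]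
    show "of_nat p ^ 2 dvd (of_nat (2 * p choose k) - 2 * of_nat (p choose k) :: 'a)"
      by simp
  qed
  finally have "of_nat p ^ 2 dvd ?S - (2 * (M * (g * F)) - ?U p)" .
  moreover have "?S - g * (A + 2) ^ (p - 1) = (?S - (2 * (M * (g * F)) - ?U p)) - g * (M - F) ^ 2"
  proof -
    have "(A + 2) ^ (p - 1) = M ^ 2"
      using p(2) by (simp add: M_def mult.commute flip: power_mult)
    then show ?thesis
      by (simp add: Up power2_eq_square algebra_simps)
  qed
  ultimately show ?thesis
    using sq by (simp only: dvd_diff)
qed

text \<open>With \<open>d = (2 * k + 1) * (2 * k + 2)\<close>, the ratios of consecutive terms are
  \<open>4 * (2 * k + 1) ^ 2 / d\<close> and \<open>4 * ((2 * k + 1) ^ 2 - p ^ 2) / d\<close>; the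
  latter uses \<open>4 * (n + k + 1) * (n - k) = p ^ 2 - (2 * k + 1) ^ 2\<close>.\<close>

lemma central_binomial_cong:
  assumes p: "prime p" "p = 2 * n + 1" and "k \<le> n"
  shows "[int (2 * k choose k) = (- 16) ^ k * int (n + k choose (2 * k))] (mod int p ^ 2)"
  using \<open>k \<le> n\<close>
proof (induction k)
  case 0
  then show ?case by simp
next
  case (Suc k)
  define d where "d = (2 * int k + 1) * (2 * int k + 2)"
  have c1: "d * int (2 * Suc k choose Suc k) = 4 * (2 * int k + 1) ^ 2 * int (2 * k choose k)"
  proof -
    have "Suc k * (2 * Suc k choose Suc k) = 2 * (Suc k * (Suc (2 * k) choose k))"
      using Suc_times_binomial[of k "Suc (2 * k)"] by (simp del: binomial_Suc_Suc)
    also have "Suc k * (Suc (2 * k) choose k) = Suc (2 * k) * (2 * k choose k)"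
      using binomial_absorb_comp[of "Suc (2 * k)" k] by (simp del: binomial_Suc_Suc)
    finally have "int (Suc k * (2 * Suc k choose Suc k)) = int (2 * (Suc (2 * k) * (2 * k choose k)))"
      by (rule arg_cong)
    then have "(int k + 1) * int (2 * Suc k choose Suc k) = 2 * (2 * int k + 1) * int (2 * k choose k)"
      unfolding of_nat_mult by (simp add: algebra_simps del: binomial_Suc_Suc)
    moreover have "d * int (2 * Suc k choose Suc k) =
        2 * (2 * int k + 1) * ((int k + 1) * int (2 * Suc k choose Suc k))"
      by (simp add: d_def algebra_simps del: binomial_Suc_Suc)
    ultimately show ?thesis
      by (simp add: power2_eq_square algebra_simps del: binomial_Suc_Suc)
  qed
  have c2: "d * int (n + Suc k choose (2 * Suc k)) =
      (int n + int k + 1) * (int n - int k) * int (n + k choose (2 * k))"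
  proof -
    obtain l where l: "n + k = Suc l"
      using Suc.prems by (cases "n + k") auto
    have "Suc (2 * k) * (n + k choose Suc (2 * k)) = (n + k - 2 * k) * (n + k choose (2 * k))"
      using Suc_times_binomial[of "2 * k" l] binomial_absorb_comp[of "n + k" "2 * k"]
      unfolding l by simp
    then have 1: "int (Suc (2 * k)) * int (n + k choose Suc (2 * k)) =
        int (n + k - 2 * k) * int (n + k choose (2 * k))"
      unfolding of_nat_mult[symmetric] by (rule arg_cong)
    have 2: "int (Suc (Suc (2 * k))) * int (n + Suc k choose (2 * Suc k)) =
        int (Suc (n + k)) * int (n + k choose Suc (2 * k))"
      using arg_cong[OF Suc_times_binomial[of "Suc (2 * k)" "n + k"], of int]
      by (simp only: of_nat_mult mult_Suc_right add_Suc_right add_2_eq_Suc)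
    have "d * int (n + Suc k choose (2 * Suc k)) =
        int (Suc (2 * k)) * (int (Suc (Suc (2 * k))) * int (n + Suc k choose (2 * Suc k)))"
      by (simp add: d_def algebra_simps del: binomial_Suc_Suc)
    also have "\<dots> = int (Suc (n + k)) * (int (n + k - 2 * k) * int (n + k choose (2 * k)))"
      unfolding 2 1[symmetric] by (rule mult.left_commute)
    also have "int (n + k - 2 * k) = int n - int k"
      using Suc.prems by simp
    also have "int (Suc (n + k)) = int n + int k + 1"
      by simp
    finally show ?thesis
      by (simp only: mult.assoc)
  qed
  have "d * ((- 16) ^ Suc k * int (n + Suc k choose (2 * Suc k)))
     = (- 16) ^ Suc k * (d * int (n + Suc k choose (2 * Suc k)))" by simp
  also have "\<dots> = 4 * ((2 * int k + 1) ^ 2 - int p ^ 2) * ((- 16) ^ k * int (n + k choose (2 * k)))"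
    unfolding c2 p(2) by (simp add: algebra_simps power2_eq_square)
  also have "[\<dots> = 4 * (2 * int k + 1) ^ 2 * int (2 * k choose k)] (mod int p ^ 2)"
  proof (rule cong_mult)
    show "[4 * ((2 * int k + 1)\<^sup>2 - (int p)\<^sup>2) = 4 * (2 * int k + 1)\<^sup>2] (mod (int p)\<^sup>2)"
      by (simp add: cong_iff_dvd_diff)
    show "[(- 16) ^ k * int (n + k choose (2 * k)) = int (2 * k choose k)] (mod (int p)\<^sup>2)"
      using Suc by (simp add: cong_sym)
  qed
  finally have "[d * int (2 * Suc k choose Suc k) = d * ((- 16) ^ Suc k * int (n + Suc k choose (2 * Suc k)))] (mod int p ^ 2)"
    unfolding c1 by (rule cong_sym)
  \<comment> \<open>In this step \<open>k < n\<close>, so both factors of \<open>d\<close> are below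
    \<open>p\<close> and \<open>d\<close> can be cancelled.\<close>
  moreover have "coprime d (int p ^ 2)"
  proof -
    have "\<not> p dvd 2 * k + 1" "\<not> p dvd 2 * k + 2"
      using Suc.prems p by (auto dest!: dvd_imp_le simp: )
    then have "\<not> p dvd (2 * k + 1) * (2 * k + 2)"
      using p(1) by (simp only: prime_dvd_mult_iff not_False_eq_True simp_thms)
    then have "coprime (int p) (int ((2 * k + 1) * (2 * k + 2)))"
      using p(1) by (metis prime_imp_coprime coprime_int_iff)
    then show ?thesis
      by (simp add: d_def coprime_commute algebra_simps)
  qed
  ultimately show ?case
    by (metis cong_mult_lcancel)
qed

section \<open>Passage from rational sums to integers, and the quadratic symbol modulo 5\<close>

lemma localization_divide:
  assumes "\<not> int p dvd d"
  shows "of_int z / of_int d \<in> localization p"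
proof -
  obtain a b where ab: "quotient_of (of_int z / of_int d) = (a, b)"
    by fastforce
  have "b > 0" "coprime a b"
    using quotient_of_denom_pos[OF ab] quotient_of_coprime[OF ab] by auto
  have "d \<noteq> 0"
    using assms by auto
  have "(of_int (z * b) :: rat) = of_int (a * d)"
    using quotient_of_div[OF ab] \<open>b > 0\<close> \<open>d \<noteq> 0\<close> by (simp add: field_simps)
  then have "z * b = a * d"
    by (simp only: of_int_eq_iff)
  then have "b dvd d"
    using \<open>coprime a b\<close> by (metis coprime_commute coprime_dvd_mult_right_iff dvd_triv_right)
  then show ?thesis
    using assms by (auto simp: localization_def ab dest: dvd_trans)
qed

text \<open>Multiplication by \<open>m ^ N\<close>, a unit of the localization, turns the rational
  congruence into a divisibility between integers.\<close>

lemma loc_cong_sumI: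
  assumes "prime p" "\<not> int p dvd m"
    and "int p ^ e dvd (\<Sum>k\<le>N. m ^ (N - k) * c k) - m ^ N * r"
  shows "loc_cong p e (\<Sum>k\<le>N. of_int (c k) / of_int m ^ k) (of_int r)"
proof -
  obtain z where z: "(\<Sum>k\<le>N. m ^ (N - k) * c k) - m ^ N * r = int p ^ e * z"
    using assms(3) by auto
  have m: "m \<noteq> 0"
    using assms(2) by auto
  have "(of_int (\<Sum>k\<le>N. m ^ (N - k) * c k) :: rat) = of_int m ^ N * (\<Sum>k\<le>N. of_int (c k) / of_int m ^ k)"
    unfolding of_int_sum sum_distrib_left
  proof (intro sum.cong refl)
    fix k assume "k \<in> {..N}"
    then have "of_int m ^ N = of_int m ^ (N - k) * (of_int m ^ k :: rat)"
      by (simp flip: power_add)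
    then show "of_int (m ^ (N - k) * c k) = of_int m ^ N * (of_int (c k) / of_int m ^ k :: rat)"
      using m by simp
  qed
  moreover have "(of_int (\<Sum>k\<le>N. m ^ (N - k) * c k) :: rat) - of_int m ^ N * of_int r = of_nat p ^ e * of_int z"
    using arg_cong[OF z, of "of_int :: int \<Rightarrow> rat"] by simp
  ultimately have "((\<Sum>k\<le>N. of_int (c k) / of_int m ^ k) - of_int r) * of_int m ^ N =
      (of_nat p ^ e * of_int z :: rat)"
    by (simp only: right_diff_distrib mult.commute)
  then have "(\<Sum>k\<le>N. of_int (c k) / of_int m ^ k) - of_int r = of_nat p ^ e * (of_int z / of_int (m ^ N) :: rat)"
    using m by (simp add: eq_divide_eq)
  moreover have "\<not> int p dvd m ^ N"
    using assms(1,2) prime_dvd_power[of "int p" m N] by auto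
  ultimately show ?thesis
    unfolding loc_cong_def using localization_divide by blast
qed

lemma Jacobi_5:
  assumes "p mod 5 \<noteq> 0"
  shows "Jacobi (int p) 5 = (if p mod 5 \<in> {1, 4} then 1 else - 1)"
proof -
  have "QuadRes 5 (int p) \<longleftrightarrow> p mod 5 \<in> {0, 1, 4}"
  proof
    assume "QuadRes 5 (int p)"
    then obtain y :: int where y: "y\<^sup>2 mod 5 = int p mod 5"
      by (auto simp: QuadRes_def cong_def)
    have "y mod 5 \<in> {0, 1, 2, 3, 4}"
      unfolding insert_iff empty_iff by presburger
    moreover have "y\<^sup>2 mod 5 = (y mod 5)\<^sup>2 mod 5"
      by (simp add: power_mod)
    ultimately have "int p mod 5 \<in> {0, 1, 4}"
      using y by auto
    then show "p mod 5 \<in> {0, 1, 4}"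
      unfolding insert_iff empty_iff by presburger
  next
    assume "p mod 5 \<in> {0, 1, 4}"
    then have "int p mod 5 \<in> {0, 1, 4}"
      unfolding insert_iff empty_iff by presburger
    then have "[0\<^sup>2 = int p] (mod 5) \<or> [1\<^sup>2 = int p] (mod 5) \<or> [2\<^sup>2 = int p] (mod 5)"
      by (auto simp: cong_def)
    then show "QuadRes 5 (int p)"
      unfolding QuadRes_def by blast
  qed
  moreover have "\<not> [int p = 0] (mod 5)"
    using assms unfolding cong_def by presburger
  ultimately show ?thesis
    using assms by (simp add: Jacobi_prime Legendre_def)
qed

section \<open>Lucas sequences under a shift by five\<close>

lemma lucas_U_small:
  "lucas_U A 2 = A" "lucas_U A 3 = A * A - 1"
  "lucas_U A 4 = A * (A * A - 1) - A" "lucas_U A 5 = A * (A * (A * A - 1) - A) - (A * A - 1)"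
  by (simp_all add: numeral_eq_Suc)

text \<open>The relation gives \<open>lucas_U A 4 = 1\<close> and \<open>lucas_U A 5 = 0\<close>, so
  the addition formula reverses the sign.\<close>

lemma lucas_U_antiperiodic:
  fixes A :: "'a::comm_ring_1"
  assumes "A * A = A + 1"
  shows "lucas_U A (n + 5 * q) = (- 1) ^ q * lucas_U A n"
proof (induction q)
  case 0
  then show ?case by simp
next
  case (Suc q)
  have "lucas_U A (m + 5) = - lucas_U A m" for m
    using lucas_U_add[of A 4 m] assms by (simp add: lucas_U_small algebra_simps)
  from this[of "n + 5 * q"] show ?case
    by (simp add: Suc.IH add_ac)
qed

text \<open>Here \<open>lucas_U A 4 = - 1\<close> and \<open>lucas_U A 5 = 0\<close>, so the sign is
  kept.\<close>

lemma lucas_U_periodic: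
  fixes A :: "'a::comm_ring_1"
  assumes "A * A = 1 - A"
  shows "lucas_U A (n + 5 * q) = lucas_U A n"
proof (induction q)
  case 0
  then show ?case by simp
next
  case (Suc q)
  have "lucas_U A (m + 5) = lucas_U A m" for m
    using lucas_U_add[of A 4 m] assms by (simp add: lucas_U_small algebra_simps)
  from this[of "n + 5 * q"] show ?case
    by (simp add: Suc.IH add_ac)
qed

section \<open>Arithmetic in the quadratic ring and the given sequences\<close>

text \<open>\<open>ZB a b\<close> stands for \<open>a + b * \<beta>\<close>, where \<open>\<beta>\<^sup>2 = 5 * \<beta> - 5\<close>.\<close>

datatype zbeta = ZB (coord0: int) (coord1: int)

instantiation zbeta :: comm_ring_1
begin

definition "0 = ZB 0 0"
definition "1 = ZB 1 0"
definition "x + y = ZB (coord0 x + coord0 y) (coord1 x + coord1 y)"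
definition "x - y = ZB (coord0 x - coord0 y) (coord1 x - coord1 y)"
definition "- x = ZB (- coord0 x) (- coord1 x)"
definition "x * y = ZB (coord0 x * coord0 y - 5 * coord1 x * coord1 y)
  (coord0 x * coord1 y + coord1 x * coord0 y + 5 * coord1 x * coord1 y)"

instance
  by standard
    (simp_all add: zero_zbeta_def one_zbeta_def plus_zbeta_def minus_zbeta_def uminus_zbeta_def
      times_zbeta_def algebra_simps)

end

lemmas zbeta_defs = zero_zbeta_def one_zbeta_def plus_zbeta_def minus_zbeta_def uminus_zbeta_def
  times_zbeta_def

lemma of_nat_zbeta: "of_nat n = ZB (int n) 0"
  by (induction n) (simp_all add: zbeta_defs)

lemma of_int_zbeta: "of_int z = ZB z 0"
  by (cases z) (simp_all add: of_nat_zbeta zbeta_defs del: of_nat_Suc)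

lemma numeral_zbeta: "numeral w = ZB (numeral w) 0"
  using of_int_zbeta[of "numeral w"] by simp

lemma coord_sum: "coord0 (sum f S) = (\<Sum>x\<in>S. coord0 (f x))" "coord1 (sum f S) = (\<Sum>x\<in>S. coord1 (f x))"
  by (induction S rule: infinite_finite_induct) (simp_all add: zbeta_defs)

lemma coord_diff: "coord0 (x - y) = coord0 x - coord0 y" "coord1 (x - y) = coord1 x - coord1 y"
  by (simp_all add: zbeta_defs)

lemma coord_of_int_mult: "coord0 (of_int z * x) = z * coord0 x" "coord1 (of_int z * x) = z * coord1 x"
  by (simp_all add: of_int_zbeta zbeta_defs)

text \<open>Since \<open>1\<close> and \<open>\<beta>\<close> form a basis over the integers, one
  divisibility in \<open>zbeta\<close> yields two integer ones, later those for
  \<open>u (k + 1)\<close> and \<open>u k\<close>.\<close>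

lemma of_int_dvd_zbeta_iff: "of_int z dvd x \<longleftrightarrow> z dvd coord0 x \<and> z dvd coord1 x"
proof
  assume "of_int z dvd x"
  then show "z dvd coord0 x \<and> z dvd coord1 x"
    by (auto simp: dvd_def coord_of_int_mult)
next
  assume "z dvd coord0 x \<and> z dvd coord1 x"
  then obtain a b where "coord0 x = z * a" "coord1 x = z * b"
    by (auto simp: dvd_def)
  then have "x = of_int z * ZB a b"
    by (simp add: zbeta.expand coord_of_int_mult)
  then show "of_int z dvd x"
    by simp
qed

text \<open>\<open>ZB 5 (- 1)\<close> is \<open>\<alpha> = 5 - \<beta>\<close>; multiplication by it
  acts on the coordinates as the recurrence of \<open>u\<close>.\<close>

lemma power_alpha:
  assumes "u 0 = 0" "u 1 = 1" "\<And>n. n \<ge> 1 \<Longrightarrow> u (n + 1) = 5 * u n - 5 * u (n - 1)"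
  shows "ZB 5 (- 1) ^ k = ZB (u (k + 1)) (- u k)"
proof (induction k)
  case 0
  then show ?case using assms by (simp add: zbeta_defs)
next
  case (Suc k)
  then show ?case using assms(3)[of "Suc k"] by (simp add: zbeta_defs)
qed

text \<open>Both sides are the trace of \<open>\<alpha> ^ n = u (n + 1) - u n * \<beta>\<close>, as
  \<open>\<beta>\<close> has trace 5. The induction carries two consecutive values.\<close>

lemma companion_eq:
  fixes u v :: "nat \<Rightarrow> int"
  assumes "u 0 = 0" "u 1 = 1" "\<And>n. n \<ge> 1 \<Longrightarrow> u (n + 1) = 5 * u n - 5 * u (n - 1)"
    and "v 0 = 2" "v 1 = 5" "\<And>n. n \<ge> 1 \<Longrightarrow> v (n + 1) = 5 * v n - 5 * v (n - 1)"
  shows "v n = 2 * u (n + 1) - 5 * u n"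
proof -
  have "v n = 2 * u (n + 1) - 5 * u n \<and> v (n + 1) = 2 * u (n + 2) - 5 * u (n + 1)"
  proof (induction n)
    case 0
    then show ?case using assms(3)[of 1] assms by (simp add: numeral_2_eq_2)
  next
    case (Suc n)
    then show ?case using assms(3)[of "Suc n"] assms(3)[of "n + 2"] assms(6)[of "Suc n"] by simp
  qed
  then show ?thesis ..
qed

section \<open>Evaluation of the sums according to \<open>p\<close> modulo 10\<close>

text \<open>\<open>n mod 5\<close> fixes \<open>p mod 10\<close>, hence the parity of
  \<open>p div 5\<close> and the symbol; \<open>n mod 5 = 2\<close> would make 5 divide
  \<open>p\<close>.\<close>

lemma half_prime_cases:
  fixes p n :: nat
  assumes "prime p" "p \<noteq> 5" "p = 2 * n + 1"
  obtains "n mod 5 = 0" "(- 1) ^ (p div 5) = (1::int)" "Jacobi (int p) 5 = 1"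
    | "n mod 5 = 1" "(- 1) ^ (p div 5) = (1::int)" "Jacobi (int p) 5 = - 1"
    | "n mod 5 = 3" "(- 1) ^ (p div 5) = (- 1::int)" "Jacobi (int p) 5 = - 1"
    | "n mod 5 = 4" "(- 1) ^ (p div 5) = (- 1::int)" "Jacobi (int p) 5 = 1"
proof -
  have "p mod 5 \<noteq> 0"
    using assms(1,2) primes_dvd_imp_eq[of 5 p] by (auto simp: mod_greater_zero_iff_not_dvd)
  with assms(3) have "n mod 5 = 0 \<and> even (p div 5) \<and> p mod 5 = 1
    \<or> n mod 5 = 1 \<and> even (p div 5) \<and> p mod 5 = 3
    \<or> n mod 5 = 3 \<and> odd (p div 5) \<and> p mod 5 = 2
    \<or> n mod 5 = 4 \<and> odd (p div 5) \<and> p mod 5 = 4"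
    by presburger
  then show ?thesis
    using that by (elim disjE conjE) (simp_all add: Jacobi_5)
qed

lemma sum_full_range_cong:
  fixes u :: "nat \<Rightarrow> int"
  assumes p: "prime p" "p \<noteq> 5" "p = 2 * n + 1"
    and u: "u 0 = 0" "u 1 = 1" "\<And>n. n \<ge> 1 \<Longrightarrow> u (n + 1) = 5 * u n - 5 * u (n - 1)"
  defines "s \<equiv> (- 1) ^ (p div 5)" and "J \<equiv> Jacobi (int p) 5"
  shows "int p ^ 2 dvd (\<Sum>k\<le>p - 1. 5 ^ (p - 1 - k) * (u k * int (2 * k choose k))) - 5 ^ (p - 1) * (s * (J - 1))"
    and "int p ^ 2 dvd (\<Sum>k\<le>p - 1. 5 ^ (p - 1 - k) * (u (k + 1) * int (2 * k choose k))) - 5 ^ (p - 1) * (s * (2 * J - 1))"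
proof -
  let ?\<alpha> = "ZB 5 (- 1)" and ?\<beta> = "ZB 0 1" and ?A = "ZB (- 2) 1"
  have \<alpha>_power: "?\<alpha> ^ k = ZB (u (k + 1)) (- u k)" for k
    using u by (rule power_alpha)
  \<comment> \<open>The coordinates are the claimed values, arranged as in
    \<open>power_alpha\<close>: first the one for \<open>u (k + 1)\<close>, then minus the one for
    \<open>u k\<close>.\<close>
  define g where "g = ZB (s * (2 * J - 1)) (- (s * (J - 1)))"
  define q where "q = n div 5"
  have A: "?A * ?A = ?A + 1" and A2: "?A + 2 = ?\<beta>"
    by (simp_all add: zbeta_defs numeral_zbeta)
  \<comment> \<open>Both sides carry the same factor \<open>(- 1) ^ q\<close>, so only four residues
    of \<open>n\<close> modulo 5 have to be checked.\<close>
  have g: "lucas_U ?A (Suc n) + lucas_U ?A n = g * (lucas_U ?A (Suc n) - lucas_U ?A n)"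
  proof -
    have *: "lucas_U ?A (Suc n) = (- 1) ^ q * lucas_U ?A (Suc (n mod 5))" "lucas_U ?A n = (- 1) ^ q * lucas_U ?A (n mod 5)"
      using lucas_U_antiperiodic[OF A, of "Suc (n mod 5)" q] lucas_U_antiperiodic[OF A, of "n mod 5" q]
      by (simp_all add: q_def)
    have mod: "lucas_U ?A (Suc (n mod 5)) + lucas_U ?A (n mod 5) =
        g * (lucas_U ?A (Suc (n mod 5)) - lucas_U ?A (n mod 5))"
      by (cases rule: half_prime_cases[OF p])
        (simp_all add: g_def s_def J_def zbeta_defs lucas_U_small)
    show ?thesis
      by (simp only: * mod mult.left_commute[of g "(- 1) ^ q"] flip: distrib_left right_diff_distrib)
  qed
  have "of_nat p ^ 2 dvd (\<Sum>k\<le>p - 1. of_nat (2 * k choose k) * ?\<beta> ^ (p - 1 - k)) - g * ?\<beta> ^ (p - 1)"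
  proof -
    have "{..<p} = {..p - 1}"
      using p(3) by auto
    then show ?thesis
      using sum_central_binomial_cong[OF p(1,3) g] unfolding A2 by simp
  qed
  \<comment> \<open>Since \<open>\<alpha> * \<beta> = 5\<close>, the new factor turns
    \<open>?\<beta> ^ (p - 1 - k)\<close> into
    \<open>5 ^ (p - 1 - k) * ?\<alpha> ^ k\<close>.\<close>
  then have "of_nat p ^ 2 dvd ?\<alpha> ^ (p - 1) * ((\<Sum>k\<le>p - 1. of_nat (2 * k choose k) * ?\<beta> ^ (p - 1 - k)) - g * ?\<beta> ^ (p - 1))"
    by (rule dvd_mult)
  also have "?\<alpha> ^ (p - 1) * ((\<Sum>k\<le>p - 1. of_nat (2 * k choose k) * ?\<beta> ^ (p - 1 - k)) - g * ?\<beta> ^ (p - 1)) =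
      (\<Sum>k\<le>p - 1. of_int (5 ^ (p - 1 - k) * int (2 * k choose k)) * ?\<alpha> ^ k) - of_int (5 ^ (p - 1)) * g"
  proof -
    have "?\<alpha> * ?\<beta> = 5"
      by (simp add: zbeta_defs numeral_zbeta)
    then have 5: "of_int (5 ^ j) = ?\<alpha> ^ j * ?\<beta> ^ j" for j
      by (metis of_int_numeral of_int_power power_mult_distrib)
    have "?\<alpha> ^ (p - 1) * (of_nat (2 * k choose k) * ?\<beta> ^ (p - 1 - k)) =
        of_int (5 ^ (p - 1 - k) * int (2 * k choose k)) * ?\<alpha> ^ k" if "k \<le> p - 1" for k
    proof -
      have "?\<alpha> ^ (p - 1) = ?\<alpha> ^ k * ?\<alpha> ^ (p - 1 - k)"
        using that by (simp only: le_add_diff_inverse flip: power_add)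
      then show ?thesis
        by (simp only: of_int_mult of_int_of_nat_eq 5 mult_ac)
    qed
    moreover have "?\<alpha> ^ (p - 1) * (g * ?\<beta> ^ (p - 1)) = of_int (5 ^ (p - 1)) * g"
      by (simp only: 5 mult_ac)
    ultimately show ?thesis
      by (simp add: right_diff_distrib sum_distrib_left)
  qed
  finally have "of_int (int p ^ 2) dvd
      (\<Sum>k\<le>p - 1. of_int (5 ^ (p - 1 - k) * int (2 * k choose k)) * ?\<alpha> ^ k) - of_int (5 ^ (p - 1)) * g"
    by simp
  then have *: "int p ^ 2 dvd (\<Sum>k\<le>p - 1. 5 ^ (p - 1 - k) * int (2 * k choose k) * u (k + 1)) - 5 ^ (p - 1) * (s * (2 * J - 1))"
      "int p ^ 2 dvd (\<Sum>k\<le>p - 1. 5 ^ (p - 1 - k) * int (2 * k choose k) * (- u k)) - 5 ^ (p - 1) * (- (s * (J - 1)))"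
    unfolding of_int_dvd_zbeta_iff coord_diff coord_sum coord_of_int_mult \<alpha>_power g_def
    by simp_all
  from *(1) show "int p ^ 2 dvd (\<Sum>k\<le>p - 1. 5 ^ (p - 1 - k) * (u (k + 1) * int (2 * k choose k))) - 5 ^ (p - 1) * (s * (2 * J - 1))"
    by (simp add: mult_ac)
  have "(\<Sum>k\<le>p - 1. 5 ^ (p - 1 - k) * int (2 * k choose k) * (- u k)) - 5 ^ (p - 1) * (- (s * (J - 1))) =
      - ((\<Sum>k\<le>p - 1. 5 ^ (p - 1 - k) * (u k * int (2 * k choose k))) - 5 ^ (p - 1) * (s * (J - 1)))"
    by (simp add: sum_negf mult_ac)
  with *(2) show "int p ^ 2 dvd (\<Sum>k\<le>p - 1. 5 ^ (p - 1 - k) * (u k * int (2 * k choose k))) - 5 ^ (p - 1) * (s * (J - 1))"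
    by (simp only: dvd_minus_iff)
qed

text \<open>The symbol is 1 or -1, so \<open>e\<close> is half of 1 minus the symbol and the
  right-hand sides stay integral.\<close>

lemma sum_half_range_cong:
  fixes u :: "nat \<Rightarrow> int"
  assumes p: "prime p" "p \<noteq> 5" "p = 2 * n + 1"
    and u: "u 0 = 0" "u 1 = 1" "\<And>n. n \<ge> 1 \<Longrightarrow> u (n + 1) = 5 * u n - 5 * u (n - 1)"
  defines "e \<equiv> (if Jacobi (int p) 5 = 1 then 0 else 1)"
  shows "int p ^ 2 dvd (\<Sum>k\<le>n. 16 ^ (n - k) * (u k * int (2 * k choose k))) - 16 ^ n * (- e)"
    and "int p ^ 2 dvd (\<Sum>k\<le>n. 16 ^ (n - k) * (u (k + 1) * int (2 * k choose k))) - 16 ^ n * (1 - 5 * e)"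
proof -
  let ?\<alpha> = "ZB 5 (- 1)" and ?A = "ZB (- 3) 1"
  have \<alpha>_power: "?\<alpha> ^ k = ZB (u (k + 1)) (- u k)" for k
    using u by (rule power_alpha)
  define q where "q = n div 5"
  have A: "?A * ?A = 1 - ?A" and A2: "?A - 2 = - ?\<alpha>"
    by (simp_all add: zbeta_defs numeral_zbeta)
  have *: "lucas_U ?A (Suc n) = lucas_U ?A (Suc (n mod 5))" "lucas_U ?A n = lucas_U ?A (n mod 5)"
    using lucas_U_periodic[OF A, of "Suc (n mod 5)" q] lucas_U_periodic[OF A, of "n mod 5" q]
    by (simp_all add: q_def)
  \<comment> \<open>At the four residues of \<open>n\<close> the difference is \<open>1\<close> or
    \<open>?A - 1 = ZB (- 4) 1\<close>; \<open>e\<close> tells which.\<close>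
  have F: "lucas_U ?A (Suc n) - lucas_U ?A n = ZB (1 - 5 * e) e"
    unfolding * by (cases rule: half_prime_cases[OF p])
      (simp_all add: e_def zbeta_defs lucas_U_small)
  have F': "(\<Sum>k\<le>n. of_int ((- 1) ^ k * int (n + k choose (2 * k))) * ?\<alpha> ^ k) = ZB (1 - 5 * e) e"
  proof -
    have "(- ?\<alpha>) ^ k = (- 1) ^ k * ?\<alpha> ^ k" for k
      by (rule power_minus)
    then show ?thesis
      using sum_choose_power_eq_lucas_U[of n ?A] unfolding F A2 by (simp add: mult_ac)
  qed
  \<comment> \<open>The factor \<open>16 ^ n\<close> comes out because
    \<open>16 ^ (n - k) * (- 16) ^ k = 16 ^ n * (- 1) ^ k\<close>.\<close>
  have termwise: "int p ^ 2 dvd 16 ^ (n - k) * (w * int (2 * k choose k)) - 16 ^ n * ((- 1) ^ k * int (n + k choose (2 * k)) * w)"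
    if "k \<le> n" for k and w :: int
  proof -
    have "int p ^ 2 dvd int (2 * k choose k) - (- 16) ^ k * int (n + k choose (2 * k))"
      using central_binomial_cong[OF p(1,3) that] by (simp add: cong_iff_dvd_diff)
    then have "int p ^ 2 dvd 16 ^ (n - k) * w * (int (2 * k choose k) - (- 16) ^ k * int (n + k choose (2 * k)))"
      by (rule dvd_mult)
    moreover have "(16::int) ^ n = 16 ^ (n - k) * 16 ^ k"
      using that by (simp flip: power_add)
    moreover have "(- 16 :: int) ^ k = (- 1) ^ k * 16 ^ k"
      by (rule power_minus)
    ultimately show ?thesis
      by (simp add: algebra_simps)
  qed
  have main: "int p ^ 2 dvd (\<Sum>k\<le>n. 16 ^ (n - k) * (w k * int (2 * k choose k)))
      - 16 ^ n * (\<Sum>k\<le>n. (- 1) ^ k * int (n + k choose (2 * k)) * w k)" for w :: "nat \<Rightarrow> int"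
    unfolding sum_distrib_left sum_subtractf[symmetric] by (intro dvd_sum termwise) simp
  have c: "(\<Sum>k\<le>n. (- 1) ^ k * int (n + k choose (2 * k)) * u (k + 1)) = 1 - 5 * e"
      "(\<Sum>k\<le>n. (- 1) ^ k * int (n + k choose (2 * k)) * u k) = - e"
    using arg_cong[OF F', of coord0] arg_cong[OF F', of coord1]
    unfolding coord_sum coord_of_int_mult \<alpha>_power by (simp_all add: sum_negf)
  show "int p ^ 2 dvd (\<Sum>k\<le>n. 16 ^ (n - k) * (u (k + 1) * int (2 * k choose k))) - 16 ^ n * (1 - 5 * e)"
    using main[of "\<lambda>k. u (k + 1)"] unfolding c .
  show "int p ^ 2 dvd (\<Sum>k\<le>n. 16 ^ (n - k) * (u k * int (2 * k choose k))) - 16 ^ n * (- e)"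
    using main[of u] unfolding c .
qed

theorem theorem1p2:
  fixes p :: nat and u v :: "nat \<Rightarrow> int"
  assumes "prime p" and "p \<noteq> 2" and "p \<noteq> 5"
    and "u 0 = 0" and "u 1 = 1"
    and "\<And>n. n \<ge> 1 \<Longrightarrow> u (n + 1) = 5 * u n - 5 * u (n - 1)"
    and "v 0 = 2" and "v 1 = 5"
    and "\<And>n. n \<ge> 1 \<Longrightarrow> v (n + 1) = 5 * v n - 5 * v (n - 1)"
  shows "loc_cong p 2 (\<Sum>k=0..p - 1. of_int (u k) / 5 ^ k * of_nat ((2 * k) choose k))
           ((- 1) ^ (p div 5) * (of_int (Jacobi (int p) 5) - 1))
    \<and> loc_cong p 2 (\<Sum>k=0..p - 1. of_int (u (k + 1)) / 5 ^ k * of_nat ((2 * k) choose k))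
           ((- 1) ^ (p div 5) * (2 * of_int (Jacobi (int p) 5) - 1))
    \<and> loc_cong p 2 (\<Sum>k=0..(p - 1) div 2. of_int (u k) / 16 ^ k * of_nat ((2 * k) choose k))
           ((of_int (Jacobi (int p) 5) - 1) / 2)
    \<and> loc_cong p 2 (\<Sum>k=0..(p - 1) div 2. of_int (v k) / 16 ^ k * of_nat ((2 * k) choose k))
           ((5 * of_int (Jacobi (int p) 5) - 1) / 2)"
proof -
  note u = assms(4-6) and uv = assms(4-9)
  have "odd p"
    using assms(1,2) primes_dvd_imp_eq[of 2 p] by auto
  then obtain n where n: "p = 2 * n + 1"
    by (rule oddE)
  let ?J = "Jacobi (int p) 5"
  define e :: int where "e = (if ?J = 1 then 0 else 1)"
  have J: "?J = 1 - 2 * e"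
    by (cases rule: half_prime_cases[OF assms(1,3) n]) (simp_all add: e_def)
  have "\<not> p dvd 5"
    using assms(1,3) primes_dvd_imp_eq[of p 5] by auto
  then have p5: "\<not> int p dvd 5"
    by (metis of_nat_dvd_iff of_nat_numeral)
  have "\<not> p dvd 2 ^ 4"
    using assms(1,2) prime_dvd_power[of p 2 4] primes_dvd_imp_eq[of p 2] by auto
  then have p16: "\<not> int p dvd 16"
    by (metis of_nat_dvd_iff of_nat_numeral power_numeral Num.pow.simps Num.sqr.simps)
  note full = sum_full_range_cong[OF assms(1,3) n, of u, OF u]
  note half = sum_half_range_cong[OF assms(1,3) n, of u, OF u, folded e_def]
  have v: "int p ^ 2 dvd (\<Sum>k\<le>n. 16 ^ (n - k) * (v k * int (2 * k choose k))) - 16 ^ n * (2 - 5 * e)"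
  proof -
    let ?S = "\<lambda>w. (\<Sum>k\<le>n. 16 ^ (n - k) * (w k * int (2 * k choose k)))"
    have "v = (\<lambda>k. 2 * u (k + 1) - 5 * u k)"
      using companion_eq[of u v, OF uv] by (rule ext)
    then have "?S v = 2 * ?S (\<lambda>k. u (k + 1)) - 5 * ?S u"
      by (simp add: sum_distrib_left sum_subtractf algebra_simps)
    then have "?S v - 16 ^ n * (2 - 5 * e) =
        2 * (?S (\<lambda>k. u (k + 1)) - 16 ^ n * (1 - 5 * e)) - 5 * (?S u - 16 ^ n * (- e))"
      by (simp add: algebra_simps)
    then show ?thesis
      using half by (simp only: dvd_diff dvd_mult)
  qed
  have p1: "(p - 1) div 2 = n"
    using n by simp
  \<comment> \<open>Substituting \<open>?J = 1 - 2 * e\<close> removes the halves, so the integer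
    divisibilities apply.\<close>
  have rhs: "(of_int ?J - 1) / 2 = (of_int (- e) :: rat)" "(5 * of_int ?J - 1) / 2 = (of_int (2 - 5 * e) :: rat)"
    by (simp_all add: J field_simps)
  show ?thesis
    using loc_cong_sumI[OF assms(1) p5 full(1)] loc_cong_sumI[OF assms(1) p5 full(2)]
      loc_cong_sumI[OF assms(1) p16 half(1)] loc_cong_sumI[OF assms(1) p16 v]
    unfolding p1 rhs by (simp add: atLeast0AtMost)
qed

end
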